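(* Let $\Sigma=\{a,b\}$ and let $St$ be the language of finite Sturmian words over $\Sigma$. The set of minimal forbidden words for $St$ is $$\{\,ywx \mid x,y\in\Sigma,\ w\in\Sigma^*,\ xwy \text{ is a non-primitive Christoffel word}\,\}.$$
   Context: Words are finite and over the alphabet $\Sigma=\{a,b\}$; $|u|_a$ is the number of occurrences of the letter $a$ in $u$; a factor is a contiguous subword; $w[i]$ is the $i$-th letter of $w$ ($1\le i\le |w|$). A word $w\in\Sigma^*$ is Sturmian if it is balanced: for any two factors $u,v$ of $w$ of the same length, $\big||u|_a-|v|_a\big|\le 1$. Let $St$ be the set of (finite) Sturmian words. A word $w\in\Sigma^*$ is a minimal forbidden word for a factorial language $L\subseteq\Sigma^*$ (one closed under taking factors) if $w\notin L$ but every proper factor of $w$ belongs to $L$; i.e. the set of minimal forbidden words for $L$ is $\Sigma L\cap L\Sigma\cap(\Sigma^*\setminus L)$. Christoffel words: for integers $p,q>0$ with $n=p+q$, the lower Christoffel word $w_{p,q}$ is the word of length $n$ defined for $1\le i\le n$ by $w_{p,q}[i]=a$ if $(iq \bmod n)>((i-1)q \bmod n)$ and $w_{p,q}[i]=b$ if $(iq \bmod n)<((i-1)q \bmod n)$. The upper Christoffel word $w'_{p,q}$ is the word of length $n$ defined by $w'_{p,q}[i]=a$ if $(ip \bmod n)<((i-1)p \bmod n)$ and $w'_{p,q}[i]=b$ if $(ip \bmod n)>((i-1)p \bmod n)$. A Christoffel word is a lower or an upper Christoffel word; $p$ and $q$ are not required to be coprime. A Christoffel word is primitive if it is a primitive word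 (not a concatenation of two or more copies of a shorter word), equivalently if $\gcd(p,q)=1$; otherwise it is non-primitive. *)

theory Defs
  imports Main "HOL-Library.Sublist"
begin

datatype letter = La | Lb

type_synonym word = "letter list"

(* Factors are contiguous subwords, i.e. sublist (not subseq) of HOL-Library.Sublist;
   proper factors are strict_sublist. *)

definition balanced :: "word \<Rightarrow> bool" where
  "balanced w \<longleftrightarrow>
     (\<forall>u v. sublist u w \<and> sublist v w \<and> length u = length v \<longrightarrow>
        \<bar>int (count_list u La) - int (count_list v La)\<bar> \<le> 1)"

definition St :: "word set" where
  "St = {w. balanced w}"

definition factorial_language :: "word set \<Rightarrow> bool" where
  "factorial_language L \<longleftrightarrow> (\<forall>w\<in>L. \<forall>u. sublist u w \<longrightarrow> u \<in> L)"

(* Meant for factorial L; St is factorial by factorial_language_St. *)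
definition minimal_forbidden :: "word set \<Rightarrow> word set" where
  "minimal_forbidden L = {w. w \<notin> L \<and> (\<forall>u. strict_sublist u w \<longrightarrow> u \<in> L)}"

(* For 0 < p, q the two residues compared are never equal (q, resp. p, is not divisible by
   p + q), so the else branch is exactly the case of the opposite strict inequality. *)
definition lower_christoffel :: "nat \<Rightarrow> nat \<Rightarrow> word" where
  "lower_christoffel p q =
     (let n = p + q in
       map (\<lambda>i. if (i * q) mod n > ((i - 1) * q) mod n then La else Lb) [1..<n + 1])"

definition upper_christoffel :: "nat \<Rightarrow> nat \<Rightarrow> word" where
  "upper_christoffel p q =
     (let n = p + q in
       map (\<lambda>i. if (i * p) mod n < ((i - 1) * p) mod n then La else Lb) [1..<n + 1])"

definition christoffel :: "word \<Rightarrow> bool" where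
  "christoffel w \<longleftrightarrow>
     (\<exists>p q. p > 0 \<and> q > 0 \<and> (w = lower_christoffel p q \<or> w = upper_christoffel p q))"

definition primitive_word :: "word \<Rightarrow> bool" where
  "primitive_word w \<longleftrightarrow>
     \<not> (\<exists>u k. k \<ge> 2 \<and> length u < length w \<and> w = concat (replicate k u))"

lemma factorial_language_St: "factorial_language St"
  unfolding factorial_language_def St_def balanced_def
  by (blast intro: sublist_order.order_trans)

end

theory Submission
  imports Defs
begin

text \<open>Let \<open>S\<close> be the prefix counts of a letter \<open>c\<close> in a word \<open>v\<close> of length \<open>n\<close>. In a minimal
  forbidden word the two factors violating balance are a prefix and a suffix of the same length
  \<open>m\<close>; for suitable \<open>c\<close> the prefix has exactly two more \<open>c\<close> than the suffix, so \<open>v\<close> starts with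
  \<open>c\<close> and does not end with it. Exchanging the two end letters replaces \<open>S i\<close> by \<open>S i - 1\<close> for
  \<open>0 < i < n\<close>, and the balance of all proper factors forces \<open>S i - 1 = \<lfloor>i p / n\<rfloor>\<close> with \<open>p = S n\<close>
  and \<open>m p\<close> divisible by \<open>n\<close>. These are the prefix counts of a Christoffel word, and the
  divisibility with \<open>0 < m < n\<close> says that \<open>gcd p n > 1\<close>, that is, that it is not primitive.\<close>

section \<open>Arithmetic of prefix sums\<close>

text \<open>For \<open>0 < t\<close>, \<open>F (t * i)\<close> is built from \<open>t\<close> copies
  of \<open>F i\<close> by \<open>t - 1\<close> additions, each with an error of 0 or 1, so the
  total error is below \<open>t\<close>. With \<open>t = n\<close> this makes \<open>F i\<close> the
  floor of \<open>F (n * i) / n\<close>.\<close>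

lemma almost_additive_multiple:
  fixes F :: "nat \<Rightarrow> int"
  assumes "F 0 = 0"
    and lo: "\<And>a b. F a + F b \<le> F (a + b)"
    and hi: "\<And>a b. F (a + b) \<le> F a + F b + 1"
  shows "int t * F i \<le> F (t * i)" and "0 < t \<Longrightarrow> F (t * i) < int t * (F i + 1)"
proof -
  show "int t * F i \<le> F (t * i)"
  proof (induction t)
    case (Suc t)
    then show ?case using lo[of i "t * i"] by (simp add: algebra_simps)
  qed (simp add: assms)
  show "F (t * i) < int t * (F i + 1)" if "0 < t"
    using that
  proof (induction t rule: nat_induct_non_zero)
    case (Suc t)
    then show ?case using hi[of i "t * i"] by (simp add: algebra_simps)
  qed simp
qed

lemma quasiperiodic_multiple:
  fixes F :: "nat \<Rightarrow> int"
  assumes "F 0 = 0" and "\<And>x. F (x + d) = F x + k"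
  shows "F (t * d) = int t * k"
proof (induction t)
  case (Suc t)
  then show ?case using assms(2)[of "t * d"] by (simp add: algebra_simps)
qed (simp add: assms)

lemma div_eqI_int:
  fixes x n q :: int
  assumes "n * q \<le> x" "x < n * (q + 1)"
  shows "x div n = q"
proof -
  have "0 < n"
    using assms by (simp add: distrib_left)
  then show ?thesis
    using assms by (intro int_div_pos_eq[where r = "x - n * q"]) (auto simp: algebra_simps)
qed

text \<open>Away from its two ends, \<open>T = S - 1\<close> satisfies \<open>T (i + m) = T i + T m\<close>, because a window of
  length \<open>m\<close> is squeezed between the first one and the last one. Hence \<open>T\<close> extends to a function
  \<open>F\<close> with quasi-period \<open>m\<close> as well as \<open>n\<close>, so \<open>F\<close> has slope \<open>S n / n\<close>, and \<open>F\<close> is additive up to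
  an error in \<open>{0, 1}\<close>.\<close>

lemma prefix_sum_eq_floor_half:
  fixes S :: "nat \<Rightarrow> int"
  assumes S0: "S 0 = 0"
    and left: "\<And>i j l. i + l < n \<Longrightarrow> j + l < n \<Longrightarrow> S (i + l) - S i \<le> S (j + l) - S j + 1"
    and right: "\<And>i j l. 0 < i \<Longrightarrow> 0 < j \<Longrightarrow> i + l \<le> n \<Longrightarrow> j + l \<le> n \<Longrightarrow>
        S (i + l) - S i \<le> S (j + l) - S j + 1"
    and m: "0 < m" "2 * m \<le> n" "S m + S (n - m) = S n + 2"
  shows "0 < i \<Longrightarrow> i < n \<Longrightarrow> S i = (int i * S n) div int n + 1"
    and "int n * (S m - 1) = int m * S n"
proof -
  define T where "T i = (if i = 0 then 0 else if i = n then S n else S i - 1)" for i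
  define k where "k = S m - 1"
  define F where "F i = T (i mod m) + k * int (i div m)" for i
  have mn: "m < n" using m by simp
  have T0: "T 0 = 0" and Tn: "T n = S n" and Tm: "T m = k"
    using m mn by (auto simp: T_def k_def)
  have Tnm: "T (n - m) = S n - k"
    using m mn by (auto simp: T_def k_def)
  have mid: "S (i + l) - S i = S l - 1"
    if l: "0 < l" "l < n" "S l + S (n - l) = S n + 2" and i: "0 < i" "i + l < n" for i l
  proof (rule antisym)
    show "S (i + l) - S i \<le> S l - 1"
      using right[of i "n - l" l] l i by simp
    show "S l - 1 \<le> S (i + l) - S i"
      using left[of 0 l i] l i S0 by simp
  qed
  \<comment> \<open>The condition on \<open>l\<close> is symmetric in \<open>l\<close> and
    \<open>n - l\<close>, so this serves both \<open>m\<close> and \<open>n - m\<close>.\<close>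
  have Tadd: "T (i + l) = T i + T l"
    if l: "0 < l" "l < n" "S l + S (n - l) = S n + 2" and i: "i + l \<le> n" for i l
  proof -
    consider "i = 0" | "0 < i" "i + l < n" | "0 < i" "i = n - l" using i l by linarith
    then show ?thesis
    proof cases
      case 2
      then show ?thesis using mid[OF l 2] l by (auto simp: T_def)
    next
      case 3
      \<comment> \<open>The excess 2 is absorbed by the two ones subtracted in \<open>T l\<close>
        and \<open>T (n - l)\<close>.\<close>
      then show ?thesis using l by (auto simp: T_def)
    qed (simp add: T0)
  qed
  have Tm_add: "T (i + m) = T i + k" if "i + m \<le> n" for i
    using Tadd[of m i] that m mn Tm by simp
  have Tnm_add: "T (i + (n - m)) = T i + (S n - k)" if "i \<le> m" for i
    using Tadd[of "n - m" i] that m mn Tnm by simp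
  have F0: "F 0 = 0" by (simp add: F_def T0)
  have Fm: "F (x + m) = F x + k" for x
    using m by (simp add: F_def div_add_self2 distrib_left)
  have Fmt: "F (x + t * m) = F x + k * int t" for x t
  proof (induction t)
    case (Suc t)
    then show ?case using Fm[of "x + t * m"] by (simp add: algebra_simps)
  qed simp
  have FT: "F i = T i" if "i \<le> n" for i
    using that
  proof (induction i rule: less_induct)
    case (less i)
    show ?case
    proof (cases "i < m")
      case True
      then show ?thesis by (simp add: F_def)
    next
      case False
      then have "F (i - m) = T (i - m)" using less m by auto
      then show ?thesis using Fm[of "i - m"] Tm_add[of "i - m"] False less.prems by simp
    qed
  qed
  have Fsplit: "F x = F (x mod m) + k * int (x div m)" for x
    using Fmt[of "x mod m" "x div m"] by simp
  have Fn: "F (x + n) = F x + S n" for x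
  proof -
    let ?r = "x mod m"
    have r: "?r < m" using m by simp
    \<comment> \<open>Moving one \<open>m\<close> out of \<open>n\<close> keeps
      \<open>?r + (n - m)\<close> below \<open>n\<close>, where \<open>F\<close> agrees with
      \<open>T\<close> and \<open>Tnm_add\<close> applies.\<close>
    have "x + n = (?r + (n - m)) + (x div m + 1) * m"
      using mn by (simp add: algebra_simps)
    then have "F (x + n) = F (?r + (n - m)) + k * (int (x div m) + 1)"
      using Fmt[of "?r + (n - m)" "x div m + 1"] by simp
    also have "F (?r + (n - m)) = T (?r + (n - m))"
      by (rule FT) (use r mn in linarith)
    also have "\<dots> = F ?r + (S n - k)"
      using Tnm_add[of ?r] FT[of ?r] r mn by simp
    finally show ?thesis using Fsplit[of x] by (simp add: algebra_simps)
  qed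
  have base: "T r + T s \<le> T (r + s) \<and> T (r + s) \<le> T r + T s + 1" if "r < m" "s < m" for r s
  proof (cases "r = 0 \<or> s = 0")
    case False
    \<comment> \<open>Reading \<open>mid\<close> with the summands exchanged, the window of length
      \<open>s\<close> at \<open>m\<close> has one less than the prefix of length \<open>s\<close>.
      Balance against this window gives the upper bound, balance against the prefix the lower one.
      All windows end before \<open>n\<close> because \<open>2 * m \<le> n\<close>.\<close>
    have "S (m + s) - S m = S s - 1" using mid[of m s] m that False mn by (simp add: add.commute)
    then show ?thesis
      using False left[of 0 s r] left[of r s m] that m S0 by (auto simp: T_def)
  qed (auto simp: T0)
  have Fadd: "F a + F b \<le> F (a + b) \<and> F (a + b) \<le> F a + F b + 1" for a b
  proof -
    let ?r = "a mod m" and ?s = "b mod m"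
    have rs: "?r < m" "?s < m" using m by simp_all
    have "a + b = (?r + ?s) + (a div m + b div m) * m"
      by (simp add: algebra_simps)
    then have "F (a + b) = F (?r + ?s) + k * (int (a div m) + int (b div m))"
      using Fmt[of "?r + ?s" "a div m + b div m"] by simp
    moreover have "F (?r + ?s) = T (?r + ?s)" "F ?r = T ?r" "F ?s = T ?s"
      using rs m by (intro FT; linarith)+
    ultimately show ?thesis
      using base[OF rs] Fsplit[of a] Fsplit[of b] by (simp add: algebra_simps)
  qed
  have slope: "F (n * i) = int i * S n" for i
    using quasiperiodic_multiple[of F n "S n" i, OF F0 Fn] by (simp add: mult.commute)
  \<comment> \<open>\<open>F (n * m)\<close> is evaluated by both quasi-periods.\<close>
  show "int n * (S m - 1) = int m * S n"
    using slope[of m] quasiperiodic_multiple[of F m k n, OF F0 Fm] by (simp add: k_def)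
  show "S i = (int i * S n) div int n + 1" if i: "0 < i" "i < n"
  proof -
    have "int n * F i \<le> int i * S n" "int i * S n < int n * (F i + 1)"
      using almost_additive_multiple[of F n i] Fadd F0 slope[of i] i by auto
    then have "(int i * S n) div int n = F i" by (rule div_eqI_int)
    then show ?thesis using i FT[of i] by (simp add: T_def)
  qed
qed

text \<open>The hypothesis on \<open>m\<close> is symmetric under exchanging \<open>m\<close> and
  \<open>n - m\<close>, so the smaller of the two serves as \<open>m'\<close> and meets
  \<open>2 * m' \<le> n\<close>.\<close>

lemma prefix_sum_eq_floor:
  fixes S :: "nat \<Rightarrow> int"
  assumes S0: "S 0 = 0"
    and left: "\<And>i j l. i + l < n \<Longrightarrow> j + l < n \<Longrightarrow> S (i + l) - S i \<le> S (j + l) - S j + 1"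
    and right: "\<And>i j l. 0 < i \<Longrightarrow> 0 < j \<Longrightarrow> i + l \<le> n \<Longrightarrow> j + l \<le> n \<Longrightarrow>
        S (i + l) - S i \<le> S (j + l) - S j + 1"
    and m: "0 < m" "m < n" "S m + S (n - m) = S n + 2"
  obtains m' where "0 < m'" "m' < n" "int n * (S m' - 1) = int m' * S n"
    "\<And>i. 0 < i \<Longrightarrow> i < n \<Longrightarrow> S i = (int i * S n) div int n + 1"
proof -
  define m' where "m' = min m (n - m)"
  have m': "0 < m'" "2 * m' \<le> n" "S m' + S (n - m') = S n + 2"
    using m by (auto simp: m'_def min_def add.commute)
  show thesis
    using prefix_sum_eq_floor_half[of S n m', OF S0 left right m'] m'
    by (intro that[of m']) auto
qed

text \<open>Each floor misses \<open>i p / n\<close> by a fraction in [0, 1), so a difference of two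
  floors misses \<open>l p / n\<close> by less than 1. Multiplying by \<open>n\<close> keeps
  everything in the integers.\<close>

lemma window_floor_bounds:
  fixes p :: int
  assumes "0 < n"
  defines "T \<equiv> \<lambda>i. (int i * p) div int n"
  shows "int l * p - int n < int n * (T (i + l) - T i)"
    and "int n * (T (i + l) - T i) < int l * p + int n"
proof -
  have T: "int n * T i \<le> int i * p \<and> int i * p < int n * T i + int n" for i
  proof -
    have "int i * p = int n * T i + (int i * p) mod int n" by (simp add: T_def)
    moreover have "0 \<le> (int i * p) mod int n" "(int i * p) mod int n < int n"
      using assms by auto
    ultimately show ?thesis by linarith
  qed
  show "int l * p - int n < int n * (T (i + l) - T i)" "int n * (T (i + l) - T i) < int l * p + int n"
    using T[of i] T[of "i + l"] by (auto simp: algebra_simps)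
qed

section \<open>Counting letters in prefixes\<close>

abbreviation pc :: "letter \<Rightarrow> word \<Rightarrow> nat \<Rightarrow> int" where
  "pc c w i \<equiv> int (count_list (take i w) c)"

lemma count_list_take_drop:
  "int (count_list (take l (drop i w)) c) = pc c w (i + l) - pc c w i"
  by (simp add: take_add)

lemma pc_Suc: "i < length w \<Longrightarrow> pc c w (Suc i) = pc c w i + (if w ! i = c then 1 else 0)"
  by (simp add: take_Suc_conv_app_nth)

lemma pc_mono: "i \<le> j \<Longrightarrow> pc c w i \<le> pc c w j"
  using count_list_take_drop[of "j - i" i w c] by simp

lemma count_list_La_Lb: "count_list w La + count_list w Lb = length w"
proof (induction w)
  case (Cons x w)
  then show ?case by (cases x) auto
qed simp

section \<open>Factors and balance as windows of prefix counts\<close>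

lemma sublist_iff_take_drop:
  "sublist u w \<longleftrightarrow> (\<exists>i l. i + l \<le> length w \<and> u = take l (drop i w))"
proof
  assume "sublist u w"
  then obtain xs ys where "w = xs @ u @ ys" by (auto simp: sublist_def)
  then show "\<exists>i l. i + l \<le> length w \<and> u = take l (drop i w)"
    by (intro exI[of _ "length xs"] exI[of _ "length u"]) auto
next
  assume "\<exists>i l. i + l \<le> length w \<and> u = take l (drop i w)"
  then show "sublist u w"
    by (metis sublist_drop sublist_order.order_trans sublist_take)
qed

text \<open>Between words of equal length an excess of one letter is a deficit of the other, so
  either letter \<open>c\<close> may be counted. The one-sided inequality suffices since
  \<open>i\<close> and \<open>j\<close> can be exchanged.\<close>

lemma balanced_iff_pc:
  "balanced w \<longleftrightarrow> (\<forall>i j l. i + l \<le> length w \<longrightarrow> j + l \<le> length w \<longrightarrow>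
     pc c w (i + l) - pc c w i \<le> pc c w (j + l) - pc c w j + 1)" (is "_ \<longleftrightarrow> ?R")
proof -
  have abs_eq: "\<bar>int (count_list u La) - int (count_list v La)\<bar> =
      \<bar>int (count_list u c) - int (count_list v c)\<bar>" if "length u = length v" for u v
    using that count_list_La_Lb[of u] count_list_La_Lb[of v] by (cases c) auto
  show ?thesis
  proof
    assume bal: "balanced w"
    show ?R
    proof (intro allI impI)
      fix i j l
      assume "i + l \<le> length w" "j + l \<le> length w"
      moreover from this have "sublist (take l (drop i w)) w" "sublist (take l (drop j w)) w"
        using sublist_iff_take_drop by blast+
      moreover from calculation have len: "length (take l (drop i w)) = length (take l (drop j w))"
        by simp
      ultimately have "\<bar>int (count_list (take l (drop i w)) La) -
          int (count_list (take l (drop j w)) La)\<bar> \<le> 1"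
        using bal unfolding balanced_def by blast
      then have "\<bar>int (count_list (take l (drop i w)) c) -
          int (count_list (take l (drop j w)) c)\<bar> \<le> 1"
        unfolding abs_eq[OF len] .
      then show "pc c w (i + l) - pc c w i \<le> pc c w (j + l) - pc c w j + 1"
        unfolding count_list_take_drop by linarith
    qed
  next
    assume R: ?R
    show "balanced w"
      unfolding balanced_def
    proof (intro allI impI, elim conjE)
      fix u v
      assume uv: "sublist u w" "sublist v w" "length u = length v"
      from uv(1) obtain i l where i: "i + l \<le> length w" "u = take l (drop i w)"
        using sublist_iff_take_drop by blast
      from uv(2) obtain j l' where j: "j + l' \<le> length w" "v = take l' (drop j w)"
        using sublist_iff_take_drop by blast
      have "l' = l" using uv(3) i j by simp
      then have "\<bar>int (count_list u c) - int (count_list v c)\<bar> \<le> 1"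
        using R[rule_format, of i l j] R[rule_format, of j l i] i j
        by (simp add: count_list_take_drop abs_le_iff)
      then show "\<bar>int (count_list u La) - int (count_list v La)\<bar> \<le> 1"
        using abs_eq uv by simp
    qed
  qed
qed

lemma pc_butlast: "i < length w \<Longrightarrow> pc c (butlast w) i = pc c w i"
  by (simp add: take_butlast)

lemma pc_tl: "w \<noteq> [] \<Longrightarrow> pc c (tl w) i = pc c w (Suc i) - pc c w 1"
  by (cases w) auto

text \<open>Counting in \<open>w\<close> itself turns this criterion and
  \<open>balanced_tl_iff\<close> into the hypotheses \<open>left\<close> and \<open>right\<close> of
  \<open>prefix_sum_eq_floor\<close>.\<close>

lemma balanced_butlast_iff:
  "balanced (butlast w) \<longleftrightarrow> (\<forall>i j l. i + l < length w \<longrightarrow> j + l < length w \<longrightarrow>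
     pc c w (i + l) - pc c w i \<le> pc c w (j + l) - pc c w j + 1)"
proof (cases "w = []")
  case True
  then show ?thesis by (simp add: balanced_def)
next
  case False
  then have len: "k \<le> length (butlast w) \<longleftrightarrow> k < length w" for k
    by (cases w rule: rev_cases) auto
  show ?thesis
    unfolding balanced_iff_pc[of "butlast w" c] len
  proof (intro all_cong1 imp_cong refl)
    fix i j l
    assume "i + l < length w" "j + l < length w"
    then show "(pc c (butlast w) (i + l) - pc c (butlast w) i
          \<le> pc c (butlast w) (j + l) - pc c (butlast w) j + 1) =
        (pc c w (i + l) - pc c w i \<le> pc c w (j + l) - pc c w j + 1)"
      using pc_butlast[of i w c] pc_butlast[of j w c] pc_butlast[of "i + l" w c]
        pc_butlast[of "j + l" w c] by linarith
  qed
qed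

lemma balanced_tl_iff:
  assumes "w \<noteq> []"
  shows "balanced (tl w) \<longleftrightarrow> (\<forall>i j l. 0 < i \<longrightarrow> 0 < j \<longrightarrow> i + l \<le> length w \<longrightarrow> j + l \<le> length w \<longrightarrow>
     pc c w (i + l) - pc c w i \<le> pc c w (j + l) - pc c w j + 1)" (is "_ \<longleftrightarrow> ?R")
proof -
  have len: "k \<le> length (tl w) \<longleftrightarrow> Suc k \<le> length w" for k
    using assms by (cases w) auto
  have bal: "balanced (tl w) \<longleftrightarrow> (\<forall>i j l. Suc (i + l) \<le> length w \<longrightarrow> Suc (j + l) \<le> length w \<longrightarrow>
     pc c w (Suc (i + l)) - pc c w (Suc i) \<le> pc c w (Suc (j + l)) - pc c w (Suc j) + 1)"
    unfolding balanced_iff_pc[of "tl w" c] len pc_tl[OF assms] by simp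
  show ?thesis
  proof
    assume "balanced (tl w)"
    note * = this[unfolded bal, rule_format]
    show ?R
    proof (intro allI impI)
      fix i j l
      assume "0 < i" "0 < j" "i + l \<le> length w" "j + l \<le> length w"
      then show "pc c w (i + l) - pc c w i \<le> pc c w (j + l) - pc c w j + 1"
        using *[of "i - 1" l "j - 1"] by simp
    qed
  next
    assume R: ?R
    show "balanced (tl w)"
      unfolding bal
    proof (intro allI impI)
      fix i j l
      assume "Suc (i + l) \<le> length w" "Suc (j + l) \<le> length w"
      then show "pc c w (Suc (i + l)) - pc c w (Suc i) \<le>
          pc c w (Suc (j + l)) - pc c w (Suc j) + 1"
        using R[rule_format, of "Suc i" "Suc j" l] by (simp only: add_Suc zero_less_Suc)
    qed
  qed
qed

section \<open>Proper factors and minimal forbidden words of \<open>St\<close>\<close>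

lemma strict_sublist_iff:
  assumes "w \<noteq> []"
  shows "strict_sublist u w \<longleftrightarrow> sublist u (butlast w) \<or> sublist u (tl w)"
proof
  assume "strict_sublist u w"
  then obtain xs ys where w: "w = xs @ u @ ys" and ne: "xs \<noteq> [] \<or> ys \<noteq> []"
    by (metis append_Nil append_Nil2 sublist_def strict_sublist_def)
  show "sublist u (butlast w) \<or> sublist u (tl w)"
  proof (cases "xs = []")
    case True
    then have "butlast w = u @ butlast ys" using w ne by (simp add: butlast_append)
    then show ?thesis by simp
  next
    case False
    then have "tl w = tl xs @ u @ ys" using w by simp
    then show ?thesis by (metis sublist_appendI)
  qed
next
  assume "sublist u (butlast w) \<or> sublist u (tl w)"
  moreover have "sublist (butlast w) w" "sublist (tl w) w"
    by (auto intro: prefixeq_butlast suffix_tl)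
  moreover have "length u \<le> length w - 1"
    using calculation(1) sublist_length_le[of u "butlast w"] sublist_length_le[of u "tl w"] by auto
  then have "u \<noteq> w" using assms by (cases w) auto
  ultimately show "strict_sublist u w"
    unfolding strict_sublist_def by (meson sublist_order.order_trans)
qed

text \<open>Every proper factor misses the first or the last letter, and \<open>St\<close> is
  factorial, so only the two longest proper factors need testing. The empty word is balanced, so it
  satisfies neither side.\<close>

lemma minimal_forbidden_St_iff:
  "w \<in> minimal_forbidden St \<longleftrightarrow> \<not> balanced w \<and> balanced (butlast w) \<and> balanced (tl w)"
proof (cases "w = []")
  case True
  then show ?thesis by (simp add: minimal_forbidden_def St_def balanced_def)
next
  case False
  then show ?thesis
    using factorial_language_St strict_sublist_iff[OF False]
    unfolding minimal_forbidden_def factorial_language_def St_def by blast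
qed

lemma eq_if_pc_eq:
  assumes "length u = length v" and "\<And>i. i \<le> length u \<Longrightarrow> pc c u i = pc c v i"
  shows "u = v"
proof (rule nth_equalityI)
  fix i
  assume i: "i < length u"
  then have "u ! i = c \<longleftrightarrow> v ! i = c"
    using assms pc_Suc[of i u c] pc_Suc[of i v c] assms(2)[of i] assms(2)[of "Suc i"]
    by (auto split: if_splits)
  then show "u ! i = v ! i" by (metis letter.exhaust)
qed (rule assms)

lemma pc_swap_ends:
  assumes "x \<noteq> c" "0 < i" "i < length w + 2"
  shows "pc c ([c] @ w @ [x]) i = pc c ([x] @ w @ [c]) i + 1"
  using assms by (cases i) (auto simp: less_Suc_eq_le)

section \<open>Christoffel words\<close>

fun swap_letter :: "letter \<Rightarrow> letter" where
  "swap_letter La = Lb"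
| "swap_letter Lb = La"

lemma swap_letter_neq [simp]: "swap_letter c \<noteq> c" "c \<noteq> swap_letter c"
  by (cases c; simp)+

lemma neq_iff_swap_letter: "x \<noteq> c \<longleftrightarrow> x = swap_letter c"
  by (cases x; cases c) auto

text \<open>The word of length \<open>n\<close> with \<open>\<lfloor>i p / n\<rfloor>\<close> letters \<open>c\<close> in its prefix of length \<open>i\<close>. It treats
  both kinds of Christoffel words at once: \<open>c = La\<close> gives the upper and \<open>c = Lb\<close> the lower ones.\<close>

definition floor_word :: "letter \<Rightarrow> nat \<Rightarrow> nat \<Rightarrow> word" where
  "floor_word c p n =
     map (\<lambda>i. if i * p div n < Suc i * p div n then c else swap_letter c) [0..<n]"

lemma length_floor_word [simp]: "length (floor_word c p n) = n"
  by (simp add: floor_word_def)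

text \<open>Adding \<open>p < n\<close> crosses at most one multiple of \<open>n\<close>: the
  residue falls by \<open>n - p\<close> on a crossing and grows by \<open>p\<close> otherwise. This
  translates the residues defining Christoffel words into floors.\<close>

lemma mod_less_iff_div_less:
  fixes p n x :: nat
  assumes "p < n" "0 < p"
  shows "(p + x) mod n < x mod n \<longleftrightarrow> x div n < (p + x) div n"
    and "(p + x) mod n \<noteq> x mod n"
    and "(p + x) div n \<le> Suc (x div n)"
proof -
  have n: "0 < n" using assms by simp
  have x: "x = n * (x div n) + x mod n" "x mod n < n"
    and y: "p + x = n * ((p + x) div n) + (p + x) mod n" "(p + x) mod n < n"
    using n by simp_all
  have le: "x div n \<le> (p + x) div n" by (simp add: div_le_mono)
  have "(p + x) div n \<le> (x + n) div n" using assms by (intro div_le_mono) simp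
  also have "\<dots> = Suc (x div n)" using n by (metis add.commute div_add_self1 neq0_conv plus_1_eq_Suc)
  finally show up: "(p + x) div n \<le> Suc (x div n)" .
  from le up consider "(p + x) div n = x div n" | "(p + x) div n = Suc (x div n)" by linarith
  then have "((p + x) mod n < x mod n \<longleftrightarrow> x div n < (p + x) div n) \<and> (p + x) mod n \<noteq> x mod n"
  proof cases
    case 1
    then have "n * ((p + x) div n) = n * (x div n)" by simp
    then have "(p + x) mod n = p + x mod n" using x(1) y(1) by linarith
    then show ?thesis using 1 assms by simp
  next
    case 2
    then have "n * ((p + x) div n) = n * (x div n) + n" by simp
    then have "n + (p + x) mod n = p + x mod n" using x(1) y(1) by linarith
    then have "(p + x) mod n < x mod n" using assms by linarith
    then show ?thesis using 2 by simp
  qed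
  then show "(p + x) mod n < x mod n \<longleftrightarrow> x div n < (p + x) div n" "(p + x) mod n \<noteq> x mod n"
    by simp_all
qed

section \<open>Christoffel words as floor words\<close>

lemma upper_christoffel_eq:
  assumes "0 < p" "0 < q"
  shows "upper_christoffel p q = floor_word La p (p + q)"
proof (rule nth_equalityI)
  show "length (upper_christoffel p q) = length (floor_word La p (p + q))"
    by (simp add: Let_def del: upt_Suc add: upper_christoffel_def)
  fix i
  assume "i < length (upper_christoffel p q)"
  then have "i < p + q" by (simp add: upper_christoffel_def Let_def del: upt_Suc)
  then show "upper_christoffel p q ! i = floor_word La p (p + q) ! i"
    using mod_less_iff_div_less(1)[of p "p + q" "i * p"] assms
    by (simp add: upper_christoffel_def floor_word_def Let_def nth_append del: upt_Suc)
qed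

lemma lower_christoffel_eq:
  assumes "0 < p" "0 < q"
  shows "lower_christoffel p q = floor_word Lb q (p + q)"
proof (rule nth_equalityI)
  show "length (lower_christoffel p q) = length (floor_word Lb q (p + q))"
    by (simp add: Let_def del: upt_Suc add: lower_christoffel_def)
  fix i
  assume "i < length (lower_christoffel p q)"
  then have "i < p + q" by (simp add: lower_christoffel_def Let_def del: upt_Suc)
  \<comment> \<open>In a lower word \<open>La\<close> marks rising residues, so \<open>Lb\<close>
    marks the crossings. Rising is the negation of falling because consecutive residues
    differ.\<close>
  moreover have "i * q mod (p + q) < (q + i * q) mod (p + q) \<longleftrightarrow>
      \<not> i * q div (p + q) < (q + i * q) div (p + q)"
    using mod_less_iff_div_less(1,2)[of q "p + q" "i * q"] assms by linarith
  ultimately show "lower_christoffel p q ! i = floor_word Lb q (p + q) ! i"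
    by (simp add: lower_christoffel_def floor_word_def Let_def nth_append del: upt_Suc)
qed

lemma christoffel_iff:
  "christoffel w \<longleftrightarrow> (\<exists>c p. 0 < p \<and> p < length w \<and> w = floor_word c p (length w))"
proof
  assume "christoffel w"
  then obtain p q where pq: "0 < p" "0 < q" "w = lower_christoffel p q \<or> w = upper_christoffel p q"
    unfolding christoffel_def by blast
  then have "w = floor_word Lb q (p + q) \<or> w = floor_word La p (p + q)"
    by (simp add: lower_christoffel_eq upper_christoffel_eq)
  then show "\<exists>c p. 0 < p \<and> p < length w \<and> w = floor_word c p (length w)"
    using pq(1,2) by (metis length_floor_word less_add_same_cancel1 less_add_same_cancel2)
next
  assume "\<exists>c p. 0 < p \<and> p < length w \<and> w = floor_word c p (length w)"
  then obtain c p where p: "0 < p" "p < length w" and w: "w = floor_word c p (length w)" by blast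
  define q where "q = length w - p"
  have q: "0 < q" "length w = p + q" "length w = q + p" using p by (simp_all add: q_def)
  show "christoffel w"
  proof (cases c)
    case La
    then have "w = upper_christoffel p q" using w p q upper_christoffel_eq[of p q] by simp
    then show ?thesis unfolding christoffel_def using p q by blast
  next
    case Lb
    then have "w = lower_christoffel q p" using w p q lower_christoffel_eq[of q p] by (simp add: add.commute)
    then show ?thesis unfolding christoffel_def using p q by blast
  qed
qed

text \<open>As \<open>p < n\<close>, the floor grows by 0 or 1 in each step and \<open>c\<close>
  marks the growth, so the counts telescope.\<close>

lemma pc_floor_word:
  assumes "0 < p" "p < n" "i \<le> n"
  shows "pc c (floor_word c p n) i = int i * int p div int n"
proof -
  have "count_list (take i (floor_word c p n)) c = i * p div n"
    using assms(3)
  proof (induction i)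
    case (Suc i)
    have "i * p div n \<le> Suc i * p div n" by (intro div_le_mono) simp
    moreover have "Suc i * p div n \<le> Suc (i * p div n)"
      using mod_less_iff_div_less(3)[of p n "i * p"] assms by simp
    moreover have "floor_word c p n ! i = c \<longleftrightarrow> i * p div n < Suc i * p div n"
      using Suc.prems by (simp add: floor_word_def)
    ultimately show ?case
      using Suc pc_Suc[of i "floor_word c p n" c] by (auto split: if_splits)
  qed simp
  then show ?thesis by (simp add: zdiv_int)
qed

text \<open>The floor is still 0 at \<open>i = 1\<close> since \<open>p < n\<close>, and still below
  its final value \<open>p\<close> at \<open>i = n - 1\<close> since \<open>0 < p\<close>.\<close>

lemma floor_word_ends:
  assumes "0 < p" "p < n" "floor_word c p n = [x] @ w @ [y]"
  shows "x = swap_letter c" "y = c"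
proof -
  have n: "n = Suc (Suc (length w))"
    using arg_cong[OF assms(3), of length] by simp
  have "pc c ([x] @ w @ [y]) 1 = int p div int n"
    using pc_floor_word[of p n 1 c] assms by simp
  then show "x = swap_letter c"
    using assms(1,2) by (auto simp: neq_iff_swap_letter[symmetric])
  have "pc c ([x] @ w @ [y]) n = int p"
    using pc_floor_word[of p n n c] assms by simp
  moreover have "pc c ([x] @ w @ [y]) (n - 1) = (int n * int p - int p) div int n"
    using pc_floor_word[of p n "n - 1" c] assms by (simp add: n algebra_simps)
  moreover have "(int n * int p - int p) div int n < int p"
  proof -
    have "(int n * int p - int p) div int n \<le> (int p * int n - 1) div int n"
      using assms by (intro zdiv_mono1) (simp_all add: mult.commute)
    also have "\<dots> = int p - 1"
      using assms by (intro div_eqI_int) (simp_all add: algebra_simps)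
    finally show ?thesis by simp
  qed
  ultimately show "y = c"
    by (auto simp: n split: if_splits)
qed

section \<open>Powers and primitivity of floor words\<close>

lemma floor_word_mult:
  assumes "0 < n"
  shows "floor_word c (g * p) (g * n) = concat (replicate g (floor_word c p n))"
proof (cases "g = 0")
  case True
  then show ?thesis by (simp add: floor_word_def)
next
  case False
  define f where "f i = (if i * p div n < Suc i * p div n then c else swap_letter c)" for i
  \<comment> \<open>A shift by \<open>n\<close> raises both compared floors by
    \<open>p\<close>.\<close>
  have fper: "f (i + n) = f i" for i
  proof -
    have "(i + n) * p = i * p + p * n" "Suc (i + n) * p = Suc i * p + p * n"
      by (simp_all add: algebra_simps)
    then show ?thesis using assms by (simp add: f_def del: mult_Suc)
  qed
  have rep: "map f [0..<t * n] = concat (replicate t (map f [0..<n]))" for t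
  proof (induction t)
    case (Suc t)
    have "[0..<Suc t * n] = [0..<n] @ map (\<lambda>i. i + n) [0..<t * n]"
      using upt_add_eq_append[of 0 n "t * n"] by (simp add: map_add_upt add.commute)
    then show ?case using Suc by (simp add: fper comp_def)
  qed simp
  have "i * (g * p) div (g * n) = i * p div n" for i
    using False by (metis div_mult_mult1 mult.left_commute)
  then have "floor_word c (g * p) (g * n) = map f [0..<g * n]"
    by (simp add: floor_word_def f_def del: mult_Suc)
  moreover have "floor_word c p n = map f [0..<n]"
    by (simp add: floor_word_def f_def)
  ultimately show ?thesis by (simp add: rep)
qed

text \<open>The right-hand side says \<open>gcd n p > 1\<close> in the form in which
  \<open>prefix_sum_eq_floor\<close> delivers it. If the word is a power of \<open>u\<close>, then
  length and number of \<open>c\<close> scale alike, so \<open>m\<close> and \<open>k\<close> are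
  those of \<open>u\<close>. Conversely a common factor \<open>g\<close> of \<open>n\<close> and
  \<open>p\<close> splits the word by \<open>floor_word_mult\<close>.\<close>

lemma floor_word_not_primitive_iff:
  assumes "0 < p" "p < n"
  shows "\<not> primitive_word (floor_word c p n) \<longleftrightarrow>
    (\<exists>m k. 0 < m \<and> m < n \<and> n * k = m * p)"
proof
  assume "\<not> primitive_word (floor_word c p n)"
  then obtain u g where g: "g \<ge> 2" "length u < n" "floor_word c p n = concat (replicate g u)"
    unfolding primitive_word_def by auto
  have count: "count_list (concat (replicate t u)) c = t * count_list u c" for t
    by (induction t) auto
  have "n = g * length u"
    using arg_cong[OF g(3), of length] by (simp add: length_concat sum_list_replicate)
  moreover have "p = g * count_list u c"
    using arg_cong[OF g(3), of "\<lambda>w. count_list w c"] pc_floor_word[of p n n c] assms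
    by (simp add: count del: of_nat_mult)
  ultimately show "\<exists>m k. 0 < m \<and> m < n \<and> n * k = m * p"
    using g assms by (intro exI[of _ "length u"] exI[of _ "count_list u c"]) auto
next
  assume "\<exists>m k. 0 < m \<and> m < n \<and> n * k = m * p"
  then obtain m k where m: "0 < m" "m < n" "n * k = m * p" by blast
  define g where "g = gcd n p"
  have "g \<noteq> 1"
  proof
    assume "g = 1"
    then have "coprime n p" by (simp add: g_def coprime_iff_gcd_eq_1)
    moreover have "n dvd m * p" using m(3) by (metis dvd_triv_left)
    ultimately have "n dvd m" by (simp add: coprime_dvd_mult_left_iff)
    then show False using m by (simp add: nat_dvd_not_less)
  qed
  moreover have "g > 0" using assms by (simp add: g_def)
  ultimately have g2: "g \<ge> 2" by simp
  obtain n' p' where np: "n = g * n'" "p = g * p'"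
    unfolding g_def by (meson dvdE gcd_dvd1 gcd_dvd2)
  have "0 < n'" using np assms by (cases n') auto
  then have "floor_word c p n = concat (replicate g (floor_word c p' n'))" "n' < n"
    using floor_word_mult[of n' c g p'] np g2 by auto
  then show "\<not> primitive_word (floor_word c p n)"
    unfolding primitive_word_def using g2 by (metis length_floor_word)
qed

section \<open>Minimal forbidden words\<close>

text \<open>Moving \<open>c\<close> to the front adds one to proper nonempty prefixes, takes one
  from proper nonempty suffixes and leaves inner windows alone. As \<open>n\<close> divides
  \<open>m p\<close>, prefix and suffix of length \<open>m\<close> both had \<open>k\<close> letters
  \<open>c\<close>, and now differ by two. Windows that all avoid the same end still differ by at
  most one.\<close>

lemma swapped_floor_word_minimal_forbidden:
  fixes n m p k :: nat
  assumes z: "[x] @ w @ [c] = floor_word c p n"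
    and p: "0 < p" "p < n" and x: "x \<noteq> c"
    and m: "0 < m" "m < n" "n * k = m * p"
  shows "[c] @ w @ [x] \<in> minimal_forbidden St"
proof -
  define v where "v = [c] @ w @ [x]"
  define T where "T i = (int i * int p) div int n" for i
  have n: "n = length w + 2" using arg_cong[OF z, of length] by simp
  have v: "length v = n" "v \<noteq> []" using n by (simp_all add: v_def)
  have pci: "pc c v i = T i + 1" if "0 < i" "i < n" for i
    using pc_swap_ends[of x c i w] that n x pc_floor_word[OF p, of i c] z
    by (simp add: v_def T_def)
  have pcn: "pc c v n = int p"
  proof -
    have "pc c v n = pc c (floor_word c p n) n"
      unfolding z[symmetric] using n x by (simp add: v_def)
    then show ?thesis using pc_floor_word[OF p, of n c] p by simp
  qed
  have T0: "T 0 = 0" and Tn: "T n = int p" using p by (simp_all add: T_def)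
  have Tm: "T m = int k"
  proof -
    have "int m * int p = int n * int k" using m(3) by (metis of_nat_mult)
    then show ?thesis using p by (simp add: T_def)
  qed
  have Tnm: "T (n - m) = int p - int k"
  proof -
    have "int (n - m) * int p = int n * (int p - int k)"
      using m by (simp add: algebra_simps flip: of_nat_mult)
    then show ?thesis using p by (simp add: T_def)
  qed
  have bounds: "int l * int p - int n < int n * (T (i + l) - T i)"
    "int n * (T (i + l) - T i) < int l * int p + int n" for i l
    using window_floor_bounds[where n = n and l = l and i = i and p = "int p"] p
    unfolding T_def by auto
  have close: "a \<le> b + 1" if "int n * a < int n * b + 2 * int n" for a b
  proof -
    have "int n * a < int n * (b + 2)" using that by (simp add: algebra_simps)
    then show ?thesis using p by simp
  qed
  have "\<not> balanced v"
  proof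
    assume "balanced v"
    note this[unfolded balanced_iff_pc[of v c], rule_format, of 0 m "n - m"]
    then have "pc c v (0 + m) - pc c v 0 \<le> pc c v (n - m + m) - pc c v (n - m) + 1"
      using m v by simp
    then show False using pci[of m] pci[of "n - m"] pcn Tm Tnm m by simp
  qed
  moreover have "balanced (butlast v)"
  proof -
    \<comment> \<open>A prefix attains the upper bound when \<open>n\<close> divides
      \<open>l p\<close>; the strict lower bound still keeps the gap between two windows below
      \<open>2 * int n\<close>, as \<open>close\<close> requires.\<close>
    have win: "int l * int p - int n < int n * (pc c v (i + l) - pc c v i) \<and>
        int n * (pc c v (i + l) - pc c v i) \<le> int l * int p + int n" if "0 < l" "i + l < n" for i l
    proof (cases "i = 0")
      case True
      have "int n * T l \<le> int l * int p" using p by (simp add: T_def minus_mod_eq_mult_div[symmetric])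
      then show ?thesis
        using True bounds[where l = l and i = 0] that pci[of l] p by (simp add: T0 algebra_simps)
    next
      case False
      then show ?thesis using bounds[where l = l and i = i] that pci[of i] pci[of "i + l"] by simp
    qed
    show ?thesis
      unfolding balanced_butlast_iff[of v c]
    proof (intro allI impI)
      fix i j l
      assume il: "i + l < length v" "j + l < length v"
      show "pc c v (i + l) - pc c v i \<le> pc c v (j + l) - pc c v j + 1"
      proof (cases "l = 0")
        case False
        then show ?thesis using il win[of l i] win[of l j] v by (intro close) linarith
      qed simp
    qed
  qed
  moreover have "balanced (tl v)"
  proof -
    \<comment> \<open>Mirror image: now a suffix may attain the lower bound, and the upper one is
      strict.\<close>
    have win: "int l * int p - int n \<le> int n * (pc c v (i + l) - pc c v i) \<and>
        int n * (pc c v (i + l) - pc c v i) < int l * int p + int n"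
      if "0 < i" "0 < l" "i + l \<le> n" for i l
    proof (cases "i + l = n")
      case True
      have "int n * T i \<le> int i * int p" using p by (simp add: T_def minus_mod_eq_mult_div[symmetric])
      moreover have "int l * int p = int n * int p - int i * int p"
        using True by (auto simp: algebra_simps)
      ultimately show ?thesis
        using True bounds[where l = l and i = i] that pci[of i] pcn Tn p by (simp add: algebra_simps)
    next
      case False
      then show ?thesis using bounds[where l = l and i = i] that pci[of i] pci[of "i + l"] by simp
    qed
    show ?thesis
      unfolding balanced_tl_iff[OF v(2), of c]
    proof (intro allI impI)
      fix i j l
      assume il: "0 < i" "0 < j" "i + l \<le> length v" "j + l \<le> length v"
      show "pc c v (i + l) - pc c v i \<le> pc c v (j + l) - pc c v j + 1"
      proof (cases "l = 0")
        case False
        then show ?thesis using il win[of i l] win[of j l] v by (intro close) linarith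
      qed simp
    qed
  qed
  ultimately show ?thesis by (simp add: minimal_forbidden_St_iff v_def)
qed

text \<open>Two windows violating balance cannot both avoid the last letter, nor both avoid the
  first, so one is a prefix and the other a suffix. If the suffix has more \<open>La\<close>, then
  the prefix has more \<open>Lb\<close>, which is then taken as \<open>c\<close>.\<close>

lemma minimal_forbidden_prefix_suffix:
  assumes "v \<in> minimal_forbidden St"
  obtains c m where "0 < m" "m < length v"
    "pc c v m + pc c v (length v - m) \<ge> pc c v (length v) + 2"
proof -
  define n where "n = length v"
  have nb: "\<not> balanced v" and bl: "balanced (butlast v)" and bt: "balanced (tl v)"
    using assms by (simp_all add: minimal_forbidden_St_iff)
  have ne: "v \<noteq> []" using nb by (auto simp: balanced_def)
  obtain i j l where ij: "i + l \<le> n" "j + l \<le> n"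
    and gt: "pc La v (i + l) - pc La v i > pc La v (j + l) - pc La v j + 1"
    using nb unfolding balanced_iff_pc[of v La] n_def by (auto simp: not_le)
  have *: "\<not> (i + l < n \<and> j + l < n)" "\<not> (0 < i \<and> 0 < j)"
    using bl bt gt ij unfolding balanced_butlast_iff[of v La] balanced_tl_iff[OF ne, of La] n_def
    by (meson not_less)+
  have ij': "i \<noteq> j" using gt by auto
  have "l \<noteq> 0" using gt by (intro notI) simp
  with * ij ij' have "i = 0 \<and> j + l = n \<and> 0 < j \<or> j = 0 \<and> i + l = n \<and> 0 < i" by arith
  then consider "i = 0" "j + l = n" "0 < j" | "j = 0" "i + l = n" "0 < i" by blast
  then show thesis
  proof cases
    case 1
    then have "n - l = j" by simp
    then show thesis
      using 1 gt \<open>l \<noteq> 0\<close> that[of l La] by (auto simp: n_def)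
  next
    case 2
    have Lb: "pc Lb v r = int r - pc La v r" if "r \<le> n" for r
    proof -
      have "count_list (take r v) La + count_list (take r v) Lb = r"
        using count_list_La_Lb[of "take r v"] that by (simp add: n_def)
      then show ?thesis by linarith
    qed
    have n: "n - l = i" "int n = int i + int l" using 2 by simp_all
    have "pc La v n - pc La v i > pc La v l + 1" using 2 gt by simp
    then have "pc Lb v l + pc Lb v (n - l) \<ge> pc Lb v n + 2"
      using Lb[of l] Lb[of i] Lb[of n] 2 n by simp
    then show thesis
      using 2 \<open>l \<noteq> 0\<close> that[of l Lb] by (simp add: n_def)
  qed
qed

lemma minimal_forbidden_swapped_floor_word:
  assumes "v \<in> minimal_forbidden St"
  obtains c p m k w x where "v = [c] @ w @ [x]" "x \<noteq> c" "0 < p" "p < length v"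
    "[x] @ w @ [c] = floor_word c p (length v)" "0 < m" "m < length v" "length v * k = m * p"
proof -
  define n where "n = length v"
  have bl: "balanced (butlast v)" and bt: "balanced (tl v)"
    using assms by (simp_all add: minimal_forbidden_St_iff)
  obtain c m where m: "0 < m" "m < n" and ge: "pc c v m + pc c v (n - m) \<ge> pc c v n + 2"
    using minimal_forbidden_prefix_suffix[OF assms] unfolding n_def by metis
  have ne: "v \<noteq> []" using m by (auto simp: n_def)
  have left: "pc c v (i + l) - pc c v i \<le> pc c v (j + l) - pc c v j + 1"
    if "i + l < n" "j + l < n" for i j l
    using bl that unfolding balanced_butlast_iff[of v c] n_def by blast
  have right: "pc c v (i + l) - pc c v i \<le> pc c v (j + l) - pc c v j + 1"
    if "0 < i" "0 < j" "i + l \<le> n" "j + l \<le> n" for i j l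
    using bt that unfolding balanced_tl_iff[OF ne, of c] n_def by blast
  \<comment> \<open>\<open>R\<close> cuts the first letter off the prefix and the suffix of length
    \<open>m\<close>, \<open>L\<close> the last letter. The excess of two would survive in
    \<open>R\<close> if \<open>v\<close> did not start with \<open>c\<close>, and in
    \<open>L\<close> if \<open>v\<close> ended with \<open>c\<close>. \<open>R\<close> also bounds
    the excess by two.\<close>
  have R: "pc c v m - pc c v 1 \<le> pc c v n - pc c v (n - m + 1) + 1"
    using right[of 1 "n - m + 1" "m - 1"] m by simp
  have L: "pc c v (m - 1) \<le> pc c v (n - 1) - pc c v (n - m) + 1"
    using left[of 0 "m - 1" "n - m"] m by simp
  have pc1: "pc c v 1 = (if v ! 0 = c then 1 else 0)"
    using pc_Suc[of 0 v c] ne by simp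
  have pcn: "pc c v n = pc c v (n - 1) + (if v ! (n - 1) = c then 1 else 0)"
    using pc_Suc[of "n - 1" v c] m by (simp add: n_def)
  have pcm: "pc c v m \<le> pc c v (m - 1) + 1"
    using pc_Suc[of "m - 1" v c] m by (auto simp: n_def)
  have mono: "pc c v (n - m) \<le> pc c v (n - m + 1)" by (rule pc_mono) simp
  have first: "v ! 0 = c"
  proof (rule ccontr)
    assume "v ! 0 \<noteq> c"
    then have "pc c v 1 = 0" using pc1 by simp
    then show False using R mono ge by linarith
  qed
  have last: "v ! (n - 1) \<noteq> c"
  proof
    assume "v ! (n - 1) = c"
    then have "pc c v n = pc c v (n - 1) + 1" using pcn by simp
    then show False using L pcm ge by linarith
  qed
  have "pc c v 1 = 1" using pc1 first by simp
  then have eq: "pc c v m + pc c v (n - m) = pc c v n + 2"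
    using R mono ge by linarith
  obtain w x where vw: "v = [c] @ w @ [x]"
  proof -
    obtain c' v' where v': "v = c' # v'" using ne by (cases v) auto
    moreover have "v' \<noteq> []" using v' m by (auto simp: n_def)
    then obtain w x where "v' = w @ [x]" by (cases v' rule: rev_cases) auto
    ultimately show thesis using first that by simp
  qed
  have x: "x \<noteq> c" using last by (simp add: vw n_def nth_append)
  define p where "p = count_list v c"
  have p: "pc c v n = int p" by (simp add: p_def n_def)
  have nw: "n = length w + 2" by (simp add: n_def vw)
  have p0: "0 < p" by (simp add: p_def vw)
  have pn: "p < n" using x nw count_le_length[of w c] by (simp add: p_def vw)
  obtain m' where m': "0 < m'" "m' < n" "int n * (pc c v m' - 1) = int m' * pc c v n"
    and flr: "\<And>i. 0 < i \<Longrightarrow> i < n \<Longrightarrow> pc c v i = (int i * pc c v n) div int n + 1"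
    using prefix_sum_eq_floor[of "pc c v" n m, OF _ left right m eq] by auto
  \<comment> \<open>Since \<open>v\<close> starts with \<open>c\<close>, this count is positive, so
    the natural subtraction in the witness for \<open>k\<close> is exact.\<close>
  have "pc c v 1 \<le> pc c v m'" using m' by (intro pc_mono) simp
  then have "count_list (take m' v) c \<ge> 1" using pc1 first by simp
  then have "int n * int (count_list (take m' v) c - 1) = int m' * int p"
    using m'(3) p by simp
  then have k: "n * (count_list (take m' v) c - 1) = m' * p"
    by (metis of_nat_eq_iff of_nat_mult)
  have "[x] @ w @ [c] = floor_word c p n"
  proof (rule eq_if_pc_eq)
    fix i
    assume "i \<le> length ([x] @ w @ [c])"
    then consider "i = 0" | "0 < i" "i < n" | "i = n" using nw by force
    then show "pc c ([x] @ w @ [c]) i = pc c (floor_word c p n) i"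
    proof cases
      case 2
      then show ?thesis
        using pc_swap_ends[of x c i w] x flr[of i] nw p pc_floor_word[OF p0 pn, of i c] vw by simp
    next
      case 3
      have "pc c ([x] @ w @ [c]) n = pc c v n" using nw x by (simp add: vw)
      then show ?thesis using 3 p p0 pn pc_floor_word[OF p0 pn, of n c] by simp
    qed simp
  qed (simp add: nw)
  then show thesis
    using that[OF vw x p0 _ _ m'(1)] pn m' k unfolding n_def by blast
qed

theorem theorem5p1:
  "minimal_forbidden St =
     {[y] @ w @ [x] | x y w. christoffel ([x] @ w @ [y]) \<and> \<not> primitive_word ([x] @ w @ [y])}"
proof (intro set_eqI iffI)
  fix v
  assume "v \<in> minimal_forbidden St"
  then obtain c p m k w x where v: "v = [c] @ w @ [x]" and p: "0 < p" "p < length v"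
    and z: "[x] @ w @ [c] = floor_word c p (length v)"
    and m: "0 < m" "m < length v" "length v * k = m * p"
    by (rule minimal_forbidden_swapped_floor_word)
  have "length v = length ([x] @ w @ [c])" by (simp add: v)
  then have "christoffel ([x] @ w @ [c])"
    unfolding christoffel_iff using p z by metis
  moreover have "\<not> primitive_word ([x] @ w @ [c])"
    unfolding z floor_word_not_primitive_iff[OF p] using m by blast
  ultimately show "v \<in> {[y] @ w @ [x] | x y w.
      christoffel ([x] @ w @ [y]) \<and> \<not> primitive_word ([x] @ w @ [y])}"
    using v by blast
next
  fix v
  assume "v \<in> {[y] @ w @ [x] | x y w.
      christoffel ([x] @ w @ [y]) \<and> \<not> primitive_word ([x] @ w @ [y])}"
  then obtain x y w where v: "v = [y] @ w @ [x]" and ch: "christoffel ([x] @ w @ [y])"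
    and np: "\<not> primitive_word ([x] @ w @ [y])" by blast
  from ch obtain c p where p: "0 < p" "p < length ([x] @ w @ [y])"
    and z: "[x] @ w @ [y] = floor_word c p (length ([x] @ w @ [y]))"
    unfolding christoffel_iff by blast
  \<comment> \<open>The end letters are forced to differ, so reversing them is the swap treated
    above.\<close>
  have xy: "x = swap_letter c" "y = c"
    using floor_word_ends[OF p z[symmetric]] by simp_all
  obtain m k where m: "0 < m" "m < length ([x] @ w @ [y])" "length ([x] @ w @ [y]) * k = m * p"
    using np z floor_word_not_primitive_iff[OF p, of c] by metis
  show "v \<in> minimal_forbidden St"
    using swapped_floor_word_minimal_forbidden[OF z[unfolded xy(2)] p[unfolded xy(2)] _ m[unfolded xy(2)]]
      xy v by simp
qed

end
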